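(* Let $G$ be a chordal graph or a graph in $\mathcal{G}_{m,n}$ for some $m,n \in \mathbb{N}\cup\{0\}$. Then the independence complex $\mathcal{I}(G)$ admits an acyclic matching $\mathcal{V}$ such that all $\mathcal{V}$-critical simplices, except possibly one $0$-dimensional simplex, are maximal simplices of $\mathcal{I}(G)$.
   Context: Graphs are finite, simple and undirected. A graph is chordal if it has no induced cycle of length at least $4$. For $m,n \in \mathbb{N}\cup\{0\}$, $\mathcal{G}_{m,n}$ is the class of graphs whose vertex set is a disjoint union $V = \bigsqcup_{i=0}^{m}\bigsqcup_{j=0}^{n} V_{i,j}$ with each $V_{i,j}\neq\emptyset$, where distinct vertices $x \in V_{i_1,j_1}$ and $y \in V_{i_2,j_2}$ are adjacent if and only if ($i_1 \le i_2$ and $j_1 \le j_2$) or ($i_1 \ge i_2$ and $j_1 \ge j_2$). The independence complex $\mathcal{I}(G)$ is the simplicial complex of all independent sets of $G$ (including $\emptyset$). An acyclic matching on a simplicial complex $\mathcal{X}$ is a set $\mathcal{V}$ of pairs $(\alpha,\beta)$ of simplices with $\alpha \subseteq \beta$, $\dim\beta=\dim\alpha+1$ (the empty simplex allowed, of dimension $-1$), each simplex in at most one pair, such that reversing the edges of $\mathcal{V}$ in the directed Hasse diagram of $\mathcal{X}$ (edges $\beta\to\alpha$ for codimension-one faces) yields no directed cycle. A non-empty simplex is $\mathcal{V}$-critical if it is unpaired in $\mathcal{V}$ or paired with $\emptyset$. *)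

theory Defs
  imports Main "Graph_Theory.Pair_Digraph"
begin

text \<open>
  A finite simple undirected graph is a \<^const>\<open>pair_graph\<close>: the edge relation \<^const>\<open>parcs\<close> is a
  symmetric, irreflexive relation on the finite vertex set \<^const>\<open>pverts\<close>.
\<close>

definition induced_cycle :: "'a pair_pre_digraph \<Rightarrow> 'a list \<Rightarrow> bool" where
  "induced_cycle G vs \<longleftrightarrow>
     3 \<le> length vs \<and> distinct vs \<and> set vs \<subseteq> pverts G \<and>
     (\<forall>i < length vs. \<forall>j < length vs.
        (vs ! i, vs ! j) \<in> parcs G \<longleftrightarrow>
        j = Suc i mod length vs \<or> i = Suc j mod length vs)"

definition chordal :: "'a pair_pre_digraph \<Rightarrow> bool" where
  "chordal G \<longleftrightarrow> \<not> (\<exists>vs. induced_cycle G vs \<and> 4 \<le> length vs)"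

definition grid_graphs :: "nat \<Rightarrow> nat \<Rightarrow> 'a pair_pre_digraph set" where
  "grid_graphs m n = {G. pair_graph G \<and>
     (\<exists>V :: nat \<Rightarrow> nat \<Rightarrow> 'a set.
        pverts G = (\<Union>i\<in>{0..m}. \<Union>j\<in>{0..n}. V i j) \<and>
        (\<forall>i\<in>{0..m}. \<forall>j\<in>{0..n}. V i j \<noteq> {}) \<and>
        (\<forall>i1\<in>{0..m}. \<forall>j1\<in>{0..n}. \<forall>i2\<in>{0..m}. \<forall>j2\<in>{0..n}.
           (i1, j1) \<noteq> (i2, j2) \<longrightarrow> V i1 j1 \<inter> V i2 j2 = {}) \<and>
        (\<forall>i1\<in>{0..m}. \<forall>j1\<in>{0..n}. \<forall>i2\<in>{0..m}. \<forall>j2\<in>{0..n}.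
           \<forall>x \<in> V i1 j1. \<forall>y \<in> V i2 j2. x \<noteq> y \<longrightarrow>
             ((x, y) \<in> parcs G \<longleftrightarrow> (i1 \<le> i2 \<and> j1 \<le> j2) \<or> (i1 \<ge> i2 \<and> j1 \<ge> j2))))}"

definition independence_complex :: "'a pair_pre_digraph \<Rightarrow> 'a set set" where
  "independence_complex G =
     {S. S \<subseteq> pverts G \<and> (\<forall>x\<in>S. \<forall>y\<in>S. (x, y) \<notin> parcs G)}"

text \<open>
  A simplicial complex is given by its set of (finite) simplices, the empty simplex included.
\<close>

definition sdim :: "'a set \<Rightarrow> int" where
  "sdim \<sigma> = int (card \<sigma>) - 1"

definition maximal_simplex :: "'a set set \<Rightarrow> 'a set \<Rightarrow> bool" where
  "maximal_simplex X \<sigma> \<longleftrightarrow> \<sigma> \<in> X \<and> (\<forall>\<tau>\<in>X. \<sigma> \<subseteq> \<tau> \<longrightarrow> \<tau> = \<sigma>)"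

text \<open>Arcs of the directed Hasse diagram go downwards, from a simplex to its codimension-one faces.\<close>

definition hasse_arcs :: "'a set set \<Rightarrow> 'a set rel" where
  "hasse_arcs X = {(\<beta>, \<alpha>). \<alpha> \<in> X \<and> \<beta> \<in> X \<and> \<alpha> \<subseteq> \<beta> \<and> sdim \<beta> = sdim \<alpha> + 1}"

text \<open>
  Pairs of a matching are written \<open>(\<alpha>, \<beta>)\<close> with the smaller simplex first, so they are converses
  of Hasse arcs: reversing the matched arcs removes \<open>M\<inverse>\<close> and adds \<open>M\<close>.
\<close>

definition acyclic_matching :: "'a set set \<Rightarrow> 'a set rel \<Rightarrow> bool" where
  "acyclic_matching X M \<longleftrightarrow>
     (\<forall>(\<alpha>, \<beta>) \<in> M. \<alpha> \<in> X \<and> \<beta> \<in> X \<and> \<alpha> \<subseteq> \<beta> \<and> sdim \<beta> = sdim \<alpha> + 1) \<and>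
     (\<forall>p\<in>M. \<forall>q\<in>M. {fst p, snd p} \<inter> {fst q, snd q} \<noteq> {} \<longrightarrow> p = q) \<and>
     acyclic ((hasse_arcs X - M\<inverse>) \<union> M)"

definition critical_simplex :: "'a set set \<Rightarrow> 'a set rel \<Rightarrow> 'a set \<Rightarrow> bool" where
  "critical_simplex X M \<sigma> \<longleftrightarrow>
     \<sigma> \<in> X \<and> \<sigma> \<noteq> {} \<and> ((\<forall>\<tau>. (\<sigma>, \<tau>) \<notin> M \<and> (\<tau>, \<sigma>) \<notin> M) \<or> ({}, \<sigma>) \<in> M)"

end

theory Submission
  imports Defs
begin

text \<open>
  Let \<open>v\<close> be a simplicial vertex, i.e. one whose neighbourhood \<open>N(v)\<close> is a clique. Independent sets
  avoiding \<open>N(v)\<close> are matched by adding or removing \<open>v\<close>. Every other independent set contains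
  exactly one \<open>w \<in> N(v)\<close>, and removing \<open>w\<close> identifies the sets through \<open>w\<close> with the independence
  complex of \<open>W - N[w]\<close>, where a matching exists recursively; its maximal simplices extended by \<open>w\<close>
  stay maximal. The map \<open>S \<mapsto> S \<inter> N(v)\<close> is monotone along the modified Hasse diagram, so a
  directed cycle would lie in a single fibre. It remains to find simplicial vertices: chordal graphs
  have them by Dirac's theorem, and in a grid graph each vertex of the corner \<open>V\<^sub>0\<^sub>,\<^sub>n\<close> is simplicial,
  while deleting \<open>N[w]\<close> for a neighbour \<open>w\<close> of such a vertex leaves a smaller grid or nothing.
\<close>

section \<open>Acyclicity of relations\<close>

text \<open>Going round a cycle, \<open>c\<close> can only descend yet returns to its initial value,
  so it is constant and the cycle lies in one fibre. The values of \<open>c\<close> will be sets,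
  truth values and numbers.\<close>

lemma acyclic_by_fibres:
  fixes c :: "'a \<Rightarrow> 'b::order"
  assumes mono: "\<And>x y. (x, y) \<in> R \<Longrightarrow> c y \<le> c x"
    and fib: "\<And>k. acyclic {(x, y) \<in> R. c x = k \<and> c y = k}"
  shows "acyclic R"
proof -
  have *: "c y < c x \<or> c y = c x \<and> (x, y) \<in> {(a, b) \<in> R. c a = c x \<and> c b = c x}\<^sup>+"
    if "(x, y) \<in> R\<^sup>+" for x y
    using that
  proof induction
    case (base y)
    then show ?case using mono[OF base] by (auto simp: order.order_iff_strict)
  next
    case (step y z)
    then show ?case using mono[OF step(2)]
      by (auto simp: order.order_iff_strict intro: trancl_into_trancl)
  qed
  show ?thesis
  proof (rule acyclicI, rule allI, rule notI)
    fix x assume "(x, x) \<in> R\<^sup>+"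
    from *[OF this] fib[of "c x"] show False by (auto simp: acyclic_def)
  qed
qed

lemma acyclic_empty: "acyclic {}"
  by (simp add: acyclic_def)

lemma acyclic_by_map:
  assumes "acyclic R'" and map: "\<And>x y. (x, y) \<in> R \<Longrightarrow> (f x, f y) \<in> R'"
  shows "acyclic R"
proof (rule acyclicI, rule allI, rule notI)
  have *: "(f x, f y) \<in> R'\<^sup>+" if "(x, y) \<in> R\<^sup>+" for x y
    using that by induction (auto intro: map trancl_into_trancl)
  fix x assume "(x, x) \<in> R\<^sup>+"
  from *[OF this] assms(1) show False by (auto simp: acyclic_def)
qed

section \<open>Independence complexes and their matchings\<close>

text \<open>With \<open>E\<close> fixed and \<open>W\<close> varying, this covers all induced
  subgraphs, so the recursion only shrinks \<open>W\<close>.\<close>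

definition indep :: "'a rel \<Rightarrow> 'a set \<Rightarrow> 'a set set" where
  "indep E W = {S. S \<subseteq> W \<and> (\<forall>x\<in>S. \<forall>y\<in>S. (x, y) \<notin> E)}"

text \<open>
  Here the empty simplex is treated like any other: if it is unmatched it must be maximal. So \<open>{}\<close> is
  matched with a vertex unless \<open>X = {{}}\<close>, and that vertex is the exceptional critical simplex.
\<close>

definition facet_matching :: "'a set set \<Rightarrow> 'a set rel \<Rightarrow> bool" where
  "facet_matching X M \<longleftrightarrow> acyclic_matching X M \<and>
     (\<forall>S\<in>X. (\<forall>T. (S, T) \<notin> M \<and> (T, S) \<notin> M) \<longrightarrow> maximal_simplex X S)"

lemma facet_matchingD:
  assumes "facet_matching X M"
  shows "(A, B) \<in> M \<Longrightarrow> A \<in> X \<and> B \<in> X \<and> A \<subseteq> B \<and> sdim B = sdim A + 1"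
    and "p \<in> M \<Longrightarrow> q \<in> M \<Longrightarrow> {fst p, snd p} \<inter> {fst q, snd q} \<noteq> {} \<Longrightarrow> p = q"
    and "acyclic ((hasse_arcs X - M\<inverse>) \<union> M)"
    and "S \<in> X \<Longrightarrow> maximal_simplex X S \<or> (\<exists>T. (S, T) \<in> M \<or> (T, S) \<in> M)"
  using assms unfolding facet_matching_def acyclic_matching_def by blast+

section \<open>Matchings built from a simplicial vertex\<close>

text \<open>For \<open>w\<close> in \<open>W\<close> and a symmetric irreflexive \<open>E\<close>,
  \<open>indep E (non_nbrs E W w)\<close> is the link of \<open>w\<close> in
  \<open>indep E W\<close>.\<close>

definition non_nbrs :: "'a rel \<Rightarrow> 'a set \<Rightarrow> 'a \<Rightarrow> 'a set" where
  "non_nbrs E W w = {x \<in> W. x \<noteq> w \<and> (w, x) \<notin> E}"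

definition simplicial :: "'a rel \<Rightarrow> 'a set \<Rightarrow> 'a \<Rightarrow> bool" where
  "simplicial E W v \<longleftrightarrow> v \<in> W \<and>
     (\<forall>x\<in>W. \<forall>y\<in>W. (v, x) \<in> E \<longrightarrow> (v, y) \<in> E \<longrightarrow> x \<noteq> y \<longrightarrow> (x, y) \<in> E)"

text \<open>Toggling \<open>v\<close> matches every set that avoids the neighbours of
  \<open>v\<close>, so an unmatched set passes through some neighbour \<open>w\<close> and comes
  from an unmatched face of the link of \<open>w\<close>.\<close>

lemma facet_matching_simplicial:
  fixes E :: "'a rel"
  assumes fin: "finite W" and sym: "sym E" and irr: "irrefl E"
    and simpl: "simplicial E W v"
    and rec: "\<And>w. w \<in> W \<Longrightarrow> (v, w) \<in> E \<Longrightarrow> \<exists>M. facet_matching (indep E (non_nbrs E W w)) M"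
  shows "\<exists>M. facet_matching (indep E W) M"
proof -
  define N where "N = {x \<in> W. (v, x) \<in> E}"
  define X where "X = indep E W"
  define Y where "Y w = indep E (non_nbrs E W w)" for w
  have vW: "v \<in> W" and vN: "v \<notin> N"
    using simpl irr by (auto simp: simplicial_def N_def irrefl_def)
  have symD: "(y, x) \<in> E" if "(x, y) \<in> E" for x y using sym that by (auto dest: symD)
  have finX: "finite S" if "S \<in> X" for S
    using that fin by (auto simp: X_def indep_def intro: finite_subset)
  \<comment> \<open>\<open>N\<close> is a clique, so an independent set meets it in at most one
    vertex.\<close>
  have one: "S \<inter> N = {w}" if "S \<in> X" "w \<in> S" "w \<in> N" for S w
    using that simpl unfolding X_def indep_def N_def simplicial_def by blast
  have ins: "insert w T \<in> X" "w \<notin> T" "insert w T \<inter> N = {w}" if "T \<in> Y w" "w \<in> N" for T w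
  proof -
    show "insert w T \<in> X" using that irr
      by (auto simp: X_def Y_def indep_def non_nbrs_def N_def irrefl_def dest: symD)
    then show "insert w T \<inter> N = {w}" using that by (intro one) auto
    show "w \<notin> T" using that by (auto simp: Y_def indep_def non_nbrs_def)
  qed
  have del: "S - {w} \<in> Y w" if "S \<in> X" "w \<in> S" for S w
    using that by (auto simp: X_def Y_def indep_def non_nbrs_def)
  obtain F where F: "\<And>w. w \<in> N \<Longrightarrow> facet_matching (Y w) (F w)"
    using rec unfolding N_def Y_def by (metis (no_types, lifting) mem_Collect_eq)
  \<comment> \<open>\<open>M0\<close> toggles \<open>v\<close> on the sets avoiding
    \<open>N\<close>; \<open>M1 w\<close> transports the matching \<open>F w\<close> of the link by
    adding \<open>w\<close>.\<close>
  define M0 where "M0 = {(S, insert v S) | S. S \<in> X \<and> S \<inter> N = {} \<and> v \<notin> S}"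
  define M1 where "M1 w = {(insert w A, insert w B) | A B. (A, B) \<in> F w}" for w
  define M where "M = M0 \<union> (\<Union>w\<in>N. M1 w)"
  have insv: "insert v S \<in> X" if "S \<in> X" "S \<inter> N = {}" for S
    using that vW irr by (auto simp: X_def indep_def N_def irrefl_def dest: symD)
  have M0: "A \<in> X \<and> B \<in> X \<and> A \<inter> N = {} \<and> B \<inter> N = {} \<and> v \<notin> A \<and> B = insert v A"
    if "(A, B) \<in> M0" for A B
    using that insv vN by (auto simp: M0_def)
  have M1: "A \<in> X \<and> B \<in> X \<and> A \<inter> N = {w} \<and> B \<inter> N = {w} \<and> (A - {w}, B - {w}) \<in> F w \<and>
      A \<subseteq> B \<and> sdim B = sdim A + 1"
    if AB: "(A, B) \<in> M1 w" and w: "w \<in> N" for A B w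
  proof -
    from AB obtain A' B' where *: "A = insert w A'" "B = insert w B'" "(A', B') \<in> F w"
      by (auto simp: M1_def)
    note D = facet_matchingD(1)[OF F[OF w] *(3)]
    then have "A' \<in> Y w" "B' \<in> Y w" by auto
    note a = ins[OF this(1) w] and b = ins[OF this(2) w]
    have "finite A'" "finite B'" using finX[OF a(1)] finX[OF b(1)] by auto
    then have "sdim B = sdim A + 1" using D a(2) b(2) by (simp add: sdim_def *)
    with * D a b show ?thesis by auto
  qed
  have M1I: "(A, B) \<in> M1 w" if "(A - {w}, B - {w}) \<in> F w" "w \<in> A" "w \<in> B" for A B w
    using that unfolding M1_def mem_Collect_eq by (metis insert_Diff)
  have M: "A \<in> X \<and> B \<in> X \<and> A \<subseteq> B \<and> sdim B = sdim A + 1 \<and> A \<inter> N = B \<inter> N"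
    if "(A, B) \<in> M" for A B
    using that unfolding M_def
  proof
    assume "(A, B) \<in> M0"
    from M0[OF this] show ?thesis using finX by (auto simp: sdim_def)
  next
    assume "(A, B) \<in> (\<Union>w\<in>N. M1 w)"
    then show ?thesis using M1 by fastforce
  qed
  \<comment> \<open>Both members of a matched pair have the same trace on \<open>N\<close>, so
    either trace tells which part of \<open>M\<close> the pair belongs to.\<close>
  have M_empty: "(A, B) \<in> M0" if "(A, B) \<in> M" "A \<inter> N = {} \<or> B \<inter> N = {}" for A B
    using that M1 unfolding M_def by fastforce
  have M_one: "(A, B) \<in> M1 w \<and> w \<in> N" if "(A, B) \<in> M" "A \<inter> N = {w} \<or> B \<inter> N = {w}" for A B w
    using that M1 M0 unfolding M_def by fastforce
  have colour: "(\<exists>w\<in>N. S \<inter> N = {w}) \<or> S \<inter> N = {}" if "S \<in> X" for S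
    using one[OF that] by blast
  have disj: "p = q" if pq: "p \<in> M" "q \<in> M" "{fst p, snd p} \<inter> {fst q, snd q} \<noteq> {}" for p q
  proof -
    obtain A B C D where p: "p = (A, B)" and q: "q = (C, D)" by (cases p, cases q)
    have AB: "(A, B) \<in> M" and CD: "(C, D) \<in> M" and meet: "{A, B} \<inter> {C, D} \<noteq> {}"
      using pq p q by auto
    have eq: "A \<inter> N = C \<inter> N" using M[OF AB] M[OF CD] meet by auto
    from colour[of A] M[OF AB] consider w where "w \<in> N" "A \<inter> N = {w}" | "A \<inter> N = {}" by blast
    then show ?thesis
    proof cases
      case 1
      have a: "(A, B) \<in> M1 w" and c: "(C, D) \<in> M1 w" using M_one[OF AB] M_one[OF CD] 1 eq by auto
      note a' = M1[OF a 1(1)] and c' = M1[OF c 1(1)]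
      have "(A - {w}, B - {w}) = (C - {w}, D - {w})"
        using a' c' meet by (intro facet_matchingD(2)[OF F[OF 1(1)]]) auto
      moreover have "w \<in> A \<inter> B \<inter> C \<inter> D" using a' c' by blast
      ultimately show ?thesis unfolding p q by (metis IntE Pair_inject insert_Diff)
    next
      case 2
      have "(A, B) \<in> M0" "(C, D) \<in> M0" using M_empty[OF AB] M_empty[OF CD] 2 eq by auto
      with meet show ?thesis unfolding p q by (auto simp: M0_def)
    qed
  qed
  let ?R = "(hasse_arcs X - M\<inverse>) \<union> M"
  have acyc: "acyclic ?R"
  proof (rule acyclic_by_fibres[where c = "\<lambda>S. S \<inter> N"])
    fix S T assume "(S, T) \<in> ?R"
    then show "T \<inter> N \<subseteq> S \<inter> N" using M by (fastforce simp: hasse_arcs_def)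
  next
    fix K
    let ?RK = "{(S, T) \<in> ?R. S \<inter> N = K \<and> T \<inter> N = K}"
    have inX: "S \<in> X \<and> T \<in> X" if "(S, T) \<in> ?R" for S T
      using that M by (auto simp: hasse_arcs_def)
    have RK_empty: "?RK = {}" if "\<nexists>S. S \<in> X \<and> S \<inter> N = K"
      using that inX by fast
    have "(\<exists>w\<in>N. K = {w}) \<or> K = {}" if "S \<in> X" "S \<inter> N = K" for S
      using colour[OF that(1)] unfolding that(2) .
    then consider w where "w \<in> N" "K = {w}" | "K = {}" | "\<nexists>S. S \<in> X \<and> S \<inter> N = K"
      by blast
    then show "acyclic ?RK"
    proof cases
      case 1
      show ?thesis
      \<comment> \<open>Deleting \<open>w\<close> maps this fibre into the modified Hasse diagram of
        the link, which is acyclic by the choice of \<open>F w\<close>.\<close>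
      proof (rule acyclic_by_map[OF facet_matchingD(3)[OF F[OF 1(1)]], where f = "\<lambda>S. S - {w}"])
        fix S T assume ST: "(S, T) \<in> ?RK"
        then have X: "S \<in> X" "T \<in> X" using inX by auto
        have wS: "w \<in> S" "w \<in> T" using ST 1 by auto
        have card: "sdim (U - {w}) = sdim U - 1" if "U \<in> X" "w \<in> U" for U
          using that finX[OF that(1)] by (cases "card U") (auto simp: sdim_def)
        show "(S - {w}, T - {w}) \<in> (hasse_arcs (Y w) - (F w)\<inverse>) \<union> F w"
        proof (cases "(S, T) \<in> M")
          case True
          then have "(S, T) \<in> M1 w" using M_one ST 1 by auto
          then show ?thesis using M1 1 by blast
        next
          case False
          then have h: "(S, T) \<in> hasse_arcs X" "(T, S) \<notin> M" using ST by auto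
          have "(T - {w}, S - {w}) \<notin> F w"
          proof
            assume "(T - {w}, S - {w}) \<in> F w"
            then have "(T, S) \<in> M1 w" using wS by (intro M1I)
            with h 1 show False by (auto simp: M_def)
          qed
          moreover have "(S - {w}, T - {w}) \<in> hasse_arcs (Y w)"
            using h wS X by (auto simp: hasse_arcs_def card intro: del)
          ultimately show ?thesis by auto
        qed
      qed
    next
      case 2
      \<comment> \<open>Every Hasse arc that removes \<open>v\<close> is reversed by
        \<open>M0\<close>; the arcs left either keep the status of \<open>v\<close> or add
        it.\<close>
      have down: "(S, T) \<in> hasse_arcs X \<and> (v \<in> S \<longleftrightarrow> v \<in> T) \<or> v \<notin> S \<and> v \<in> T" if "(S, T) \<in> ?RK" for S T
      proof (cases "(S, T) \<in> M")
        case True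
        then have "(S, T) \<in> M0" using M_empty that 2 by blast
        then show ?thesis using M0 by blast
      next
        case False
        then have h: "(S, T) \<in> hasse_arcs X" "(T, S) \<notin> M" using that by auto
        then have st: "T \<subseteq> S" "S \<in> X" "T \<in> X" "card S = Suc (card T)"
          by (auto simp: hasse_arcs_def sdim_def)
        have "v \<in> T" if v: "v \<in> S"
        proof (rule ccontr)
          assume nv: "v \<notin> T"
          have "insert v T = S"
            using st v nv finX[of S] finX[of T] by (intro card_subset_eq) auto
          then have "(T, S) \<in> M0" using st nv \<open>(S, T) \<in> ?RK\<close> 2 by (auto simp: M0_def)
          with h show False by (simp add: M_def)
        qed
        with h st show ?thesis by auto
      qed
      show ?thesis
      \<comment> \<open>On truth values \<le> is implication, so \<open>v \<notin> S\<close>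
        descends: once gained, \<open>v\<close> is never lost.\<close>
      proof (rule acyclic_by_fibres[where c = "\<lambda>S. v \<notin> S"])
        fix S T assume "(S, T) \<in> ?RK"
        from down[OF this] show "(v \<notin> T) \<le> (v \<notin> S)" by auto
      next
        fix b
        \<comment> \<open>With the status of \<open>v\<close> frozen, only downward Hasse arcs
          remain.\<close>
        have *: "card T < card S" if "(S, T) \<in> {(S, T) \<in> ?RK. (v \<notin> S) = b \<and> (v \<notin> T) = b}" for S T
          using that down by (fastforce simp: hasse_arcs_def sdim_def)
        show "acyclic {(S, T) \<in> ?RK. (v \<notin> S) = b \<and> (v \<notin> T) = b}"
        proof (rule acyclic_by_fibres[where c = card])
          fix k
          have "{(S, T) \<in> {(S, T) \<in> ?RK. (v \<notin> S) = b \<and> (v \<notin> T) = b}. card S = k \<and> card T = k} = {}"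
            using * by fastforce
          then show "acyclic {(S, T) \<in> {(S, T) \<in> ?RK. (v \<notin> S) = b \<and> (v \<notin> T) = b}. card S = k \<and> card T = k}"
            by (simp only: acyclic_empty)
        qed (use * in \<open>fastforce intro: less_imp_le\<close>)
      qed
    next
      case 3
      show ?thesis unfolding RK_empty[OF 3] by (rule acyclic_empty)
    qed
  qed
  have max: "maximal_simplex X S" if S: "S \<in> X" and free: "\<And>T. (S, T) \<notin> M \<and> (T, S) \<notin> M" for S
  proof -
    consider w where "w \<in> N" "w \<in> S" | "S \<inter> N = {}" by blast
    then show ?thesis
    proof cases
      case 1
      have Y: "S - {w} \<in> Y w" using del S 1 by auto
      have "(insert w (S - {w}), insert w T) \<in> M" if "(S - {w}, T) \<in> F w" for T
        using that 1 unfolding M_def M1_def by blast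
      moreover have "(insert w T, insert w (S - {w})) \<in> M" if "(T, S - {w}) \<in> F w" for T
        using that 1 unfolding M_def M1_def by blast
      moreover have "insert w (S - {w}) = S" using 1 by blast
      ultimately have "(S - {w}, T) \<notin> F w" "(T, S - {w}) \<notin> F w" for T
        using free by metis+
      then have mx: "maximal_simplex (Y w) (S - {w})"
        using facet_matchingD(4)[OF F[OF 1(1)] Y] by auto
      show ?thesis unfolding maximal_simplex_def
      proof (intro conjI S ballI impI)
        \<comment> \<open>A simplex above \<open>S\<close> also contains \<open>w\<close>, so
          maximality can be tested in the link.\<close>
        fix T assume T: "T \<in> X" "S \<subseteq> T"
        then have "T - {w} = S - {w}"
          using mx del[OF T(1), of w] 1(2) unfolding maximal_simplex_def
          by (meson Diff_mono order_refl subsetD)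
        then show "T = S" using T 1 by blast
      qed
    next
      case 2
      \<comment> \<open>Whether or not \<open>v\<close> lies in \<open>S\<close>, \<open>M0\<close>
        matches \<open>S\<close>, contradicting \<open>free\<close>.\<close>
      show ?thesis
      proof (cases "v \<in> S")
        case True
        then have "(S - {v}, S) \<in> M0"
          using S 2 by (auto simp: M0_def X_def indep_def insert_absorb)
        then show ?thesis using free by (auto simp: M_def)
      next
        case False
        then have "(S, insert v S) \<in> M0" using S 2 by (auto simp: M0_def)
        then show ?thesis using free by (auto simp: M_def)
      qed
    qed
  qed
  have "facet_matching X M"
    unfolding facet_matching_def acyclic_matching_def
  proof (intro conjI ballI impI)
    show "case p of (A, B) \<Rightarrow> A \<in> X \<and> B \<in> X \<and> A \<subseteq> B \<and> sdim B = sdim A + 1" if "p \<in> M" for p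
      using M that by (cases p) simp
    show "maximal_simplex X S" if "S \<in> X" "\<forall>T. (S, T) \<notin> M \<and> (T, S) \<notin> M" for S
      using max that by simp
  qed (rule disj acyc; assumption)+
  then show ?thesis unfolding X_def by blast
qed

text \<open>\<open>P\<close> is an invariant preserved when the closed neighbourhood of a neighbour
  of the chosen \<open>v\<close> is deleted; each deletion strictly shrinks
  \<open>W\<close>.\<close>

lemma facet_matching_recursive:
  fixes E :: "'a rel"
  assumes "sym E" "irrefl E"
    and step: "\<And>W. P W \<Longrightarrow> W \<noteq> {} \<Longrightarrow>
      \<exists>v. simplicial E W v \<and> (\<forall>w\<in>W. (v, w) \<in> E \<longrightarrow> P (non_nbrs E W w))"
    and "finite W" "P W"
  shows "\<exists>M. facet_matching (indep E W) M"
  using assms(4,5)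
proof (induction W rule: finite_psubset_induct)
  case (psubset W)
  show ?case
  proof (cases "W = {}")
    case True
    \<comment> \<open>Without vertices the only simplex is \<open>{}\<close>, unmatched but
      maximal.\<close>
    have "hasse_arcs (indep E {}) = {}" by (auto simp: hasse_arcs_def indep_def)
    then have "facet_matching (indep E W) {}"
      using True by (auto simp: facet_matching_def acyclic_matching_def maximal_simplex_def indep_def acyclic_empty)
    then show ?thesis by blast
  next
    case False
    with step psubset.prems obtain v where v: "simplicial E W v"
      "\<And>w. w \<in> W \<Longrightarrow> (v, w) \<in> E \<Longrightarrow> P (non_nbrs E W w)" by blast
    have "non_nbrs E W w \<subset> W" if "w \<in> W" for w using that by (auto simp: non_nbrs_def)
    with v psubset show ?thesis by (intro facet_matching_simplicial[OF _ assms(1,2) v(1)]) auto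
  qed
qed

section \<open>Chordal graphs\<close>

definition chordal_on :: "'a rel \<Rightarrow> 'a set \<Rightarrow> bool" where
  "chordal_on E W \<longleftrightarrow> (\<forall>vs. distinct vs \<longrightarrow> set vs \<subseteq> W \<longrightarrow> 4 \<le> length vs \<longrightarrow>
     \<not> (\<forall>i < length vs. \<forall>j < length vs. (vs ! i, vs ! j) \<in> E \<longleftrightarrow>
        j = Suc i mod length vs \<or> i = Suc j mod length vs))"

lemma chordal_on_subset: "chordal_on E W \<Longrightarrow> U \<subseteq> W \<Longrightarrow> chordal_on E U"
  unfolding chordal_on_def by blast

text \<open>A shortest walk from \<open>x\<close> to \<open>y\<close> inside \<open>T\<close> is an
  induced path, since a repeated vertex or a chord would give a shortcut.\<close>

lemma induced_path:
  assumes "sym E" "irrefl E" "(x, y) \<in> (E \<inter> T \<times> T)\<^sup>*" "x \<in> T"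
  obtains k f where "f 0 = x" "f k = y" "inj_on f {..k}" "f ` {..k} \<subseteq> T"
    "\<And>i j. i \<le> k \<Longrightarrow> j \<le> k \<Longrightarrow> (f i, f j) \<in> E \<longleftrightarrow> j = Suc i \<or> i = Suc j"
proof -
  let ?R = "E \<inter> T \<times> T"
  define k where "k = (LEAST k. (x, y) \<in> ?R ^^ k)"
  have k: "(x, y) \<in> ?R ^^ k" unfolding k_def
    using assms(3) by (metis LeastI rtrancl_imp_relpow)
  have least: "k \<le> l" if "(x, y) \<in> ?R ^^ l" for l unfolding k_def using that by (rule Least_le)
  obtain f where f: "f 0 = x" "f k = y" "\<And>i. i < k \<Longrightarrow> (f i, f (Suc i)) \<in> ?R"
    using k unfolding relpow_fun_conv by blast
  have seg: "(f i, f (i + d)) \<in> ?R ^^ d" if "i + d \<le> k" for i d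
    using that f(3) by (induction d) auto
  have pre: "(x, f i) \<in> ?R ^^ i" if "i \<le> k" for i using seg[of 0 i] that f by simp
  have suf: "(f i, y) \<in> ?R ^^ (k - i)" if "i \<le> k" for i using seg[of i "k - i"] that f by simp
  have T: "f i \<in> T" if "i \<le> k" for i
    using that f assms(4) by (cases i) (auto simp: Suc_le_eq)
  have no_chord: "(f i, f j) \<notin> E" if "Suc i < j" "j \<le> k" for i j
  proof
    assume "(f i, f j) \<in> E"
    then have "(f i, f j) \<in> ?R" using T that by auto
    \<comment> \<open>The walk to \<open>f i\<close>, the chord and the walk from \<open>f j\<close>
      have fewer than \<open>k\<close> arcs together, as \<open>Suc i < j\<close>.\<close>
    then have "(x, y) \<in> ?R ^^ (Suc i + (k - j))"
      using pre[of i] suf[of j] that unfolding relpow_add by auto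
    from least[OF this] that show False by simp
  qed
  have neq: "f i \<noteq> f j" if "i < j" "j \<le> k" for i j
  proof
    assume "f i = f j"
    then have "(x, y) \<in> ?R ^^ (i + (k - j))"
      using pre[of i] suf[of j] that unfolding relpow_add by auto
    from least[OF this] that show False by simp
  qed
  show ?thesis
  proof
    show "inj_on f {..k}" using neq by (intro linorder_inj_onI') auto
    fix i j assume ij: "i \<le> k" "j \<le> k"
    have "(f i, f j) \<in> E \<longleftrightarrow> (f j, f i) \<in> E" using assms(1) by (auto dest: symD)
    moreover have "(f i, f i) \<notin> E" using assms(2) by (auto simp: irrefl_def)
    ultimately show "(f i, f j) \<in> E \<longleftrightarrow> j = Suc i \<or> i = Suc j"
      using ij no_chord[of i j] no_chord[of j i] f(3)[of i] f(3)[of j]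
      by (cases i j rule: linorder_cases) (auto simp: Suc_le_eq not_less, (metis Suc_lessI)+)
  qed (use f T in auto)
qed

text \<open>Otherwise an induced path from \<open>x\<close> to \<open>y\<close> in \<open>T\<close>
  closes up through \<open>u\<close> to a long induced cycle, as its inner vertices are not adjacent
  to \<open>u\<close>.\<close>

lemma chordal_link_edge:
  assumes ch: "chordal_on E W" and sym: "sym E" and irr: "irrefl E"
    and u: "u \<in> W" and x: "x \<in> W" "(u, x) \<in> E" and y: "y \<in> W" "(u, y) \<in> E" and "x \<noteq> y"
    and conn: "(x, y) \<in> (E \<inter> T \<times> T)\<^sup>*" and T: "T = non_nbrs E W u \<union> {x, y}"
  shows "(x, y) \<in> E"
proof (rule ccontr)
  assume xy: "(x, y) \<notin> E"
  have symD: "(b, a) \<in> E" if "(a, b) \<in> E" for a b using sym that by (auto dest: symD)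
  obtain k f where f: "f 0 = x" "f k = y" and inj: "inj_on f {..k}" and fT: "f ` {..k} \<subseteq> T"
    and adj: "\<And>i j. i \<le> k \<Longrightarrow> j \<le> k \<Longrightarrow> (f i, f j) \<in> E \<longleftrightarrow> j = Suc i \<or> i = Suc j"
    using induced_path[OF sym irr conn] T by (metis UnCI insertI1)
  \<comment> \<open>Distinct non-adjacent ends force at least two arcs, so the cycle has
    \<open>k + 2 \<ge> 4\<close> vertices.\<close>
  have "k \<noteq> 0" "k \<noteq> 1" using f \<open>x \<noteq> y\<close> xy adj[of 0 k] by (metis, force)
  then have k: "2 \<le> k" by simp
  define vs where "vs = u # map f [0..<Suc k]"
  have len: "length vs = k + 2" by (simp add: vs_def)
  have nth: "vs ! 0 = u" "\<And>i. i \<le> k \<Longrightarrow> vs ! Suc i = f i"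
    unfolding vs_def by (simp_all del: upt_Suc)
  have uu: "(u, u) \<notin> E" using irr by (auto simp: irrefl_def)
  have set: "set vs = insert u (f ` {..k})"
    by (auto simp: vs_def atLeast0LessThan lessThan_Suc_atMost simp del: upt_Suc)
  have uf: "(u, f i) \<in> E \<longleftrightarrow> i = 0 \<or> i = k" if "i \<le> k" for i
  proof
    assume e: "(u, f i) \<in> E"
    have "f i \<in> T" using fT that by auto
    then have "f i = x \<or> f i = y" using e T by (auto simp: non_nbrs_def)
    then show "i = 0 \<or> i = k" using inj f that by (auto dest!: inj_onD)
  qed (use f x y in auto)
  have "u \<notin> f ` {..k}" using fT T uu x y by (auto simp: non_nbrs_def)
  then have "distinct vs" using inj
    by (auto simp: vs_def distinct_map atLeast0LessThan lessThan_Suc_atMost simp del: upt_Suc)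
  moreover have "set vs \<subseteq> W" using set fT T u x y by (auto simp: non_nbrs_def)
  moreover have "(vs ! i, vs ! j) \<in> E \<longleftrightarrow> j = Suc i mod length vs \<or> i = Suc j mod length vs"
    if "i < length vs" "j < length vs" for i j
  proof -
    have fu: "(f l, u) \<in> E \<longleftrightarrow> l = 0 \<or> l = k" if "l \<le> k" for l
      using uf[OF that] symD by blast
    \<comment> \<open>Since \<open>u\<close> stands first, \<open>f i\<close> has index
      \<open>Suc i\<close>, and the cycle wraps only at index \<open>Suc k\<close>.\<close>
    have sm: "Suc l mod length vs = (if l = Suc k then 0 else Suc l)" if "l < length vs" for l
      using that len by (auto simp: mod_less)
    show ?thesis
      using that k unfolding sm[OF that(1)] sm[OF that(2)]
      by (cases i; cases j) (auto simp: nth uu uf fu adj len)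
  qed
  ultimately show False using ch k len unfolding chordal_on_def by (metis add_le_mono1 numeral_Bit0)
qed

text \<open>
  The induction needs the second conjunct: with \<open>C\<close> a component of \<open>W - N[u]\<close> and \<open>S\<close> the neighbours
  of \<open>C\<close> in \<open>N(u)\<close>, which form a clique, a simplicial vertex of \<open>C \<union> S\<close> is simplicial in \<open>W\<close> only
  if it lies in \<open>C\<close>, and this is forced by making it avoid some \<open>s \<in> S\<close>.
\<close>

lemma chordal_simplicial_avoiding:
  assumes "finite W" "sym E" "irrefl E" "chordal_on E W"
  shows "(W \<noteq> {} \<longrightarrow> (\<exists>v. simplicial E W v)) \<and>
    (\<forall>u\<in>W. non_nbrs E W u \<noteq> {} \<longrightarrow> (\<exists>v\<in>non_nbrs E W u. simplicial E W v))"
  using assms(1,4)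
proof (induction W rule: finite_psubset_induct)
  case (psubset W)
  have symD: "(b, a) \<in> E" if "(a, b) \<in> E" for a b using assms(2) that by (auto dest: symD)
  have avoid: "\<exists>v\<in>non_nbrs E W u. simplicial E W v"
    if u: "u \<in> W" and ne: "non_nbrs E W u \<noteq> {}" for u
  proof -
    let ?A = "non_nbrs E W u"
    let ?R = "E \<inter> ?A \<times> ?A"
    obtain c where c: "c \<in> ?A" using ne by blast
    define C where "C = {z. (c, z) \<in> ?R\<^sup>*}"
    define S where "S = {s \<in> W. (u, s) \<in> E \<and> (\<exists>z\<in>C. (s, z) \<in> E)}"
    have symR: "sym (?R\<^sup>*)" using assms(2) by (intro sym_rtrancl) (auto simp: sym_def)
    have cC: "c \<in> C" by (simp add: C_def)
    have CA: "C \<subseteq> ?A" 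
    proof
      fix z assume "z \<in> C"
      then have "(c, z) \<in> ?R\<^sup>*" by (simp add: C_def)
      then show "z \<in> ?A" using c by (induction) auto
    qed
    have nbr: "y \<in> C \<union> S" if "z \<in> C" "y \<in> W" "(z, y) \<in> E" for y z
    proof (cases "(u, y) \<in> E")
      case True
      then show ?thesis using that symD by (auto simp: S_def)
    next
      case False
      have "z \<in> ?A" using CA that by auto
      then have "y \<in> ?A" "z \<in> ?A" using False that symD by (auto simp: non_nbrs_def)
      then have "y \<in> C" using that by (auto simp: C_def intro: rtrancl_into_rtrancl)
      then show ?thesis by simp
    qed
    \<comment> \<open>Both vertices have neighbours in the connected set \<open>C\<close>, so a walk
      through \<open>C\<close> joins them inside \<open>?T\<close> and
      \<open>chordal_link_edge\<close> applies.\<close>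
    have clique: "(x, y) \<in> E" if xy: "x \<in> S" "y \<in> S" "x \<noteq> y" for x y
    proof -
      obtain a b where ab: "a \<in> C" "(x, a) \<in> E" "b \<in> C" "(y, b) \<in> E" using xy by (auto simp: S_def)
      let ?T = "?A \<union> {x, y}"
      let ?RT = "E \<inter> ?T \<times> ?T"
      have "(a, b) \<in> ?R\<^sup>*" using ab(1,3) symR unfolding C_def by (metis mem_Collect_eq rtrancl_trans symE)
      then have "(a, b) \<in> ?RT\<^sup>*" by (rule rtrancl_mono[THEN subsetD, rotated]) auto
      moreover have "(x, a) \<in> ?RT" "(b, y) \<in> ?RT" using ab CA symD by auto
      ultimately have "(x, y) \<in> ?RT\<^sup>*" by (meson converse_rtrancl_into_rtrancl rtrancl_into_rtrancl)
      moreover have "x \<in> W" "(u, x) \<in> E" "y \<in> W" "(u, y) \<in> E" using xy by (auto simp: S_def)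
      ultimately show ?thesis
        using chordal_link_edge[OF psubset.prems assms(2,3) u _ _ _ _ xy(3), of ?T] by blast
    qed
    \<comment> \<open>By \<open>nbr\<close>, all neighbours in \<open>W\<close> of a vertex of
      \<open>C\<close> already lie in \<open>C \<union> S\<close>.\<close>
    have lift: "simplicial E W v" if "simplicial E (C \<union> S) v" "v \<in> C" for v
      using that nbr CA unfolding simplicial_def non_nbrs_def by blast
    \<comment> \<open>The vertex \<open>u\<close> lies in neither set, so the induction hypothesis
      covers both.\<close>
    have sub: "C \<union> S \<subset> W" "C \<subset> W"
      using CA u assms(3) by (auto simp: S_def non_nbrs_def irrefl_def)
    have "\<exists>v\<in>C. simplicial E (C \<union> S) v"
    proof (cases "\<exists>s\<in>S. non_nbrs E (C \<union> S) s \<noteq> {}")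
      case True
      then obtain s where s: "s \<in> S" "non_nbrs E (C \<union> S) s \<noteq> {}" by blast
      then obtain v where v: "v \<in> non_nbrs E (C \<union> S) s" "simplicial E (C \<union> S) v"
        using psubset.IH[OF sub(1) chordal_on_subset[OF psubset.prems]] sub by blast
      \<comment> \<open>All other vertices of \<open>S\<close> are adjacent to \<open>s\<close>, so
        a vertex avoiding \<open>s\<close> lies in \<open>C\<close>.\<close>
      then have "v \<in> C" using clique[OF s(1)] by (auto simp: non_nbrs_def)
      with v show ?thesis by blast
    next
      case False
      obtain v where v: "simplicial E C v"
        using psubset.IH[OF sub(2) chordal_on_subset[OF psubset.prems]] sub cC by blast
      \<comment> \<open>Each \<open>s\<close> in \<open>S\<close> is joined to the rest of
        \<open>C \<union> S\<close>, so adding \<open>S\<close> keeps the neighbourhood of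
        \<open>v\<close> a clique.\<close>
      have "(s, z) \<in> E" if "s \<in> S" "z \<in> C \<union> S" "z \<noteq> s" for s z
        using False that by (auto simp: non_nbrs_def)
      then have "simplicial E (C \<union> S) v"
        using v symD unfolding simplicial_def by (metis Un_iff)
      with v show ?thesis by (auto simp: simplicial_def)
    qed
    then show ?thesis using lift CA by blast
  qed
  moreover have "\<exists>v. simplicial E W v" if "w \<in> W" for w
  proof (cases "\<forall>u\<in>W. non_nbrs E W u = {}")
    case True
    then have "simplicial E W w" using that by (auto simp: simplicial_def non_nbrs_def)
    then show ?thesis by blast
  next
    case False
    then show ?thesis using avoid by blast
  qed
  ultimately show ?case by blast
qed

lemma facet_matching_chordal:
  assumes "finite W" "sym E" "irrefl E" "chordal_on E W"
  shows "\<exists>M. facet_matching (indep E W) M"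
proof (rule facet_matching_recursive[where P = "\<lambda>W. finite W \<and> chordal_on E W"])
  fix W assume "finite W \<and> chordal_on E W" "W \<noteq> {}"
  moreover from this obtain v where "simplicial E W v"
    using chordal_simplicial_avoiding[OF _ assms(2,3)] by blast
  moreover have "non_nbrs E W w \<subseteq> W" for w by (auto simp: non_nbrs_def)
  ultimately show "\<exists>v. simplicial E W v \<and>
      (\<forall>w\<in>W. (v, w) \<in> E \<longrightarrow> finite (non_nbrs E W w) \<and> chordal_on E (non_nbrs E W w))"
    by (meson chordal_on_subset finite_subset)
qed (use assms in auto)

section \<open>Grid graphs\<close>

text \<open>A vertex of \<open>V i j\<close> misses exactly the quadrants
  \<open>i' > i, j' < j\<close> and \<open>i' < i, j' > j\<close>. For a neighbour of the corner the
  second lies outside the grid, so the non-neighbours form a smaller grid or nothing.\<close>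

lemma facet_matching_grid:
  fixes V :: "nat \<Rightarrow> nat \<Rightarrow> 'a set"
  assumes "sym E" "irrefl E"
    and fin: "finite (\<Union>i\<in>{0..m}. \<Union>j\<in>{0..n}. V i j)"
    and ne: "\<And>i j. i \<le> m \<Longrightarrow> j \<le> n \<Longrightarrow> V i j \<noteq> {}"
    and disj: "\<And>i1 j1 i2 j2. i1 \<le> m \<Longrightarrow> j1 \<le> n \<Longrightarrow> i2 \<le> m \<Longrightarrow> j2 \<le> n \<Longrightarrow>
      (i1, j1) \<noteq> (i2, j2) \<Longrightarrow> V i1 j1 \<inter> V i2 j2 = {}"
    and adj: "\<And>i1 j1 i2 j2 x y. i1 \<le> m \<Longrightarrow> j1 \<le> n \<Longrightarrow> i2 \<le> m \<Longrightarrow> j2 \<le> n \<Longrightarrow>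
      x \<in> V i1 j1 \<Longrightarrow> y \<in> V i2 j2 \<Longrightarrow> x \<noteq> y \<Longrightarrow>
      (x, y) \<in> E \<longleftrightarrow> (i1 \<le> i2 \<and> j1 \<le> j2) \<or> (i1 \<ge> i2 \<and> j1 \<ge> j2)"
  shows "\<exists>M. facet_matching (indep E (\<Union>i\<in>{0..m}. \<Union>j\<in>{0..n}. V i j)) M"
proof -
  \<comment> \<open>The strict bound on \<open>j\<close> lets \<open>b = 0\<close> stand for the
    empty set, which is what remains after choosing \<open>w\<close> with
    \<open>j = 0\<close>.\<close>
  define B where "B a b = (\<Union>i\<in>{a..m}. \<Union>j\<in>{..<b}. V i j)" for a b
  show ?thesis
  proof (rule facet_matching_recursive[where P = "\<lambda>W. \<exists>a b. b \<le> Suc n \<and> W = B a b"])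
    fix W assume "\<exists>a b. b \<le> Suc n \<and> W = B a b" and "W \<noteq> {}"
    then obtain a b' where ab': "b' \<le> Suc n" "W = B a b'" by (elim exE conjE)
    from \<open>W \<noteq> {}\<close> have "a \<le> m" "b' \<noteq> 0" unfolding ab'(2) B_def by auto
    with ab' obtain b where W: "W = B a (Suc b)" and ab: "a \<le> m" "b \<le> n" by (cases b') auto
    obtain v where v: "v \<in> V a b" using ne ab by blast
    have vW: "v \<in> W" using v ab by (auto simp: W B_def)
    \<comment> \<open>Comparability with the corner \<open>(a, b)\<close> together with
      \<open>i \<ge> a\<close> and \<open>j \<le> b\<close> forces \<open>i = a\<close> or
      \<open>j = b\<close>.\<close>
    have edge: "\<exists>i j. w \<in> V i j \<and> i \<le> m \<and> j \<le> b \<and> a \<le> i \<and> (i = a \<or> j = b)"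
      if w: "w \<in> W" "(v, w) \<in> E" for w
    proof -
      obtain i j where ij: "w \<in> V i j" "a \<le> i" "i \<le> m" "j \<le> b" using w(1) by (auto simp: W B_def)
      moreover have "v \<noteq> w" using w assms(2) by (auto simp: irrefl_def)
      ultimately have "a \<le> i \<and> b \<le> j \<or> i \<le> a \<and> j \<le> b"
        using adj[of a b i j v w] ab v w(2) by auto
      then show ?thesis using ij by (metis order_antisym)
    qed
    \<comment> \<open>The positions \<open>(a, j)\<close> and \<open>(i, b)\<close> of the block
      form a chain in the componentwise order, so the neighbours of \<open>v\<close> are pairwise
      adjacent.\<close>
    have "simplicial E W v" unfolding simplicial_def
    proof (intro conjI vW ballI impI)
      fix x y assume "x \<in> W" "y \<in> W" "(v, x) \<in> E" "(v, y) \<in> E" "x \<noteq> y"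
      with edge obtain i j i' j' where
        "x \<in> V i j" "i \<le> m" "j \<le> b" "a \<le> i" "i = a \<or> j = b"
        "y \<in> V i' j'" "i' \<le> m" "j' \<le> b" "a \<le> i'" "i' = a \<or> j' = b" by metis
      with adj[of i j i' j' x y] \<open>x \<noteq> y\<close> ab show "(x, y) \<in> E" by auto
    qed
    moreover have "\<exists>a b. b \<le> Suc n \<and> non_nbrs E W w = B a b" if "w \<in> W" "(v, w) \<in> E" for w
    proof -
      obtain i j where w: "w \<in> V i j" "i \<le> m" "j \<le> b" "a \<le> i" and ij: "i = a \<or> j = b"
        using edge[OF \<open>w \<in> W\<close> \<open>(v, w) \<in> E\<close>] by blast
      have "x \<in> non_nbrs E W w \<longleftrightarrow> x \<in> B (Suc i) j" for x
      proof
        assume x: "x \<in> non_nbrs E W w"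
        then obtain i' j' where x': "x \<in> V i' j'" "a \<le> i'" "i' \<le> m" "j' \<le> b" "x \<noteq> w" "(w, x) \<notin> E"
          by (auto simp: non_nbrs_def W B_def)
        then have "i < i' \<and> j' < j" using adj[of i j i' j' w x] w ab ij by auto
        then show "x \<in> B (Suc i) j" using x' by (auto simp: B_def)
      next
        assume "x \<in> B (Suc i) j"
        then obtain i' j' where x': "x \<in> V i' j'" "i < i'" "i' \<le> m" "j' < j" by (auto simp: B_def)
        moreover have "x \<noteq> w" using disj[of i j i' j'] w ab x' by auto
        ultimately have "(w, x) \<notin> E" using adj[of i j i' j' w x] w ab by auto
        then show "x \<in> non_nbrs E W w" using x' \<open>x \<noteq> w\<close> w ab by (fastforce simp: non_nbrs_def W B_def)
      qed
      then have "non_nbrs E W w = B (Suc i) j" by blast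
      moreover have "j \<le> Suc n" using w ab by simp
      ultimately show ?thesis by blast
    qed
    ultimately show "\<exists>v. simplicial E W v \<and>
        (\<forall>w\<in>W. (v, w) \<in> E \<longrightarrow> (\<exists>a b. b \<le> Suc n \<and> non_nbrs E W w = B a b))" by blast
  next
    show "\<exists>a b. b \<le> Suc n \<and> (\<Union>i\<in>{0..m}. \<Union>j\<in>{0..n}. V i j) = B a b"
      by (rule exI[of _ 0], rule exI[of _ "Suc n"])
        (simp add: B_def lessThan_Suc_atMost atMost_atLeast0)
  qed (use assms in auto)
qed

section \<open>Critical simplices and the theorem\<close>

text \<open>Apart from the partner of \<open>{}\<close>, critical simplices are unmatched and hence
  maximal. If \<open>{}\<close> has no partner, it is itself maximal, so \<open>X = {{}}\<close> and
  nothing is critical.\<close>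

lemma facet_matching_critical:
  assumes fm: "facet_matching X M" and X: "{} \<in> X"
  shows "\<exists>\<sigma>\<^sub>0. sdim \<sigma>\<^sub>0 = 0 \<and>
      (\<forall>\<sigma>. critical_simplex X M \<sigma> \<and> \<sigma> \<noteq> \<sigma>\<^sub>0 \<longrightarrow> maximal_simplex X \<sigma>)"
proof (cases "\<exists>\<sigma>. ({}, \<sigma>) \<in> M")
  case True
  then obtain \<sigma>\<^sub>0 where s: "({}, \<sigma>\<^sub>0) \<in> M" by blast
  then have "sdim \<sigma>\<^sub>0 = 0" using facet_matchingD(1)[OF fm s] by (simp add: sdim_def)
  moreover have "\<sigma> = \<sigma>\<^sub>0" if "({}, \<sigma>) \<in> M" for \<sigma>
    using facet_matchingD(2)[OF fm that s] by simp
  ultimately show ?thesis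
    using facet_matchingD(4)[OF fm] unfolding critical_simplex_def by blast
next
  case False
  then have "\<forall>T. ({}, T) \<notin> M \<and> (T, {}) \<notin> M"
    using facet_matchingD(1)[OF fm] by (fastforce simp: sdim_def)
  then have "X \<subseteq> {{}}" using facet_matchingD(4)[OF fm X] by (auto simp: maximal_simplex_def)
  then have "\<not> critical_simplex X M \<sigma>" for \<sigma> by (auto simp: critical_simplex_def)
  \<comment> \<open>With no critical simplices, any set of dimension 0 serves as
    \<open>\<sigma>\<^sub>0\<close>, even one outside \<open>X\<close>.\<close>
  moreover have "sdim {undefined} = 0" by (simp add: sdim_def)
  ultimately show ?thesis by blast
qed

theorem theorem1p2:
  fixes G :: "'a pair_pre_digraph"
  assumes "pair_graph G"
    and "chordal G \<or> (\<exists>m n :: nat. G \<in> grid_graphs m n)"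
  shows "\<exists>M. acyclic_matching (independence_complex G) M \<and>
    (\<exists>\<sigma>\<^sub>0. sdim \<sigma>\<^sub>0 = 0 \<and>
      (\<forall>\<sigma>. critical_simplex (independence_complex G) M \<sigma> \<and> \<sigma> \<noteq> \<sigma>\<^sub>0 \<longrightarrow>
        maximal_simplex (independence_complex G) \<sigma>))"
proof -
  interpret pair_graph G by fact
  have sym: "sym (parcs G)" by (auto simp: sym_def intro: arcs_symmetric)
  have irr: "irrefl (parcs G)" by (auto simp: irrefl_def dest: no_loops)
  have fin: "finite (pverts G)" by simp
  have ic: "independence_complex G = indep (parcs G) (pverts G)"
    by (simp add: independence_complex_def indep_def)
  have "\<exists>M. facet_matching (independence_complex G) M"
    using assms(2)
  proof
    assume "chordal G"
    have "chordal_on (parcs G) (pverts G)" unfolding chordal_on_def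
    proof (intro allI impI notI)
      fix vs :: "'a list"
      assume "4 \<le> length vs" "distinct vs" "set vs \<subseteq> pverts G"
        "\<forall>i < length vs. \<forall>j < length vs. (vs ! i, vs ! j) \<in> parcs G \<longleftrightarrow>
          j = Suc i mod length vs \<or> i = Suc j mod length vs"
      then have "induced_cycle G vs" unfolding induced_cycle_def by (intro conjI) simp_all
      with \<open>chordal G\<close> \<open>4 \<le> length vs\<close> show False unfolding chordal_def by blast
    qed
    then show ?thesis unfolding ic by (rule facet_matching_chordal[OF fin sym irr])
  next
    assume "\<exists>m n. G \<in> grid_graphs m n"
    then obtain m n :: nat and V :: "nat \<Rightarrow> nat \<Rightarrow> 'a set" where V: "pverts G = (\<Union>i\<in>{0..m}. \<Union>j\<in>{0..n}. V i j)"
      and ne: "\<forall>i\<in>{0..m}. \<forall>j\<in>{0..n}. V i j \<noteq> {}"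
      and disj: "\<forall>i1\<in>{0..m}. \<forall>j1\<in>{0..n}. \<forall>i2\<in>{0..m}. \<forall>j2\<in>{0..n}.
           (i1, j1) \<noteq> (i2, j2) \<longrightarrow> V i1 j1 \<inter> V i2 j2 = {}"
      and adj: "\<forall>i1\<in>{0..m}. \<forall>j1\<in>{0..n}. \<forall>i2\<in>{0..m}. \<forall>j2\<in>{0..n}.
           \<forall>x \<in> V i1 j1. \<forall>y \<in> V i2 j2. x \<noteq> y \<longrightarrow>
             ((x, y) \<in> parcs G \<longleftrightarrow> (i1 \<le> i2 \<and> j1 \<le> j2) \<or> (i1 \<ge> i2 \<and> j1 \<ge> j2))"
      unfolding grid_graphs_def mem_Collect_eq by (elim exE conjE)
    show ?thesis using fin unfolding ic V
      by (rule facet_matching_grid[OF sym irr]) (simp_all add: ne disj adj)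
  qed
  then obtain M where M: "facet_matching (independence_complex G) M" by blast
  have "acyclic_matching (independence_complex G) M"
    using M by (simp add: facet_matching_def)
  moreover have "{} \<in> independence_complex G" by (simp add: independence_complex_def)
  ultimately show ?thesis using facet_matching_critical[OF M] by (intro exI[of _ M] conjI)
qed

end
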